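(* Let $n\in\mathbb{N}$ and $\alpha\in\mathbb{Z}^n$. Let $s\in\mathbb{Z}$. Then, in the algebra $\operatorname{NSym}$, $$\mathfrak{S}_\alpha H_s=\sum_{\substack{\beta\in\mathbb{Z}^{n+1};\\ |\beta|=|\alpha|+s;\\ \alpha_i\le\beta_i\text{ for all }i\in[n];\\ 0\le\beta_{n+1}}}\mathfrak{S}_\beta.$$
   Context: $\mathbb{N}=\{0,1,2,\ldots\}$ and $[n]=\{1,2,\ldots,n\}$. For a tuple $\alpha\in\mathbb{Z}^m$, $\alpha_i$ is its $i$-th entry and $|\alpha|:=\alpha_1+\cdots+\alpha_m$. $S_m$ is the group of permutations of $[m]$, and $(-1)^\sigma$ is the sign of $\sigma$. Fix a commutative ring $\mathbf{k}$. $\operatorname{NSym}$ is the (free associative, unital) algebra of noncommutative polynomials in countably many variables $H_1,H_2,H_3,\ldots$ over $\mathbf{k}$. Set $H_0:=1$ and $H_k:=0$ for all $k<0$. For every $m\in\mathbb{N}$ and every $\alpha\in\mathbb{Z}^m$, set $H_\alpha:=H_{\alpha_1}H_{\alpha_2}\cdots H_{\alpha_m}\in\operatorname{NSym}$ and $$\mathfrak{S}_\alpha:=\sum_{\sigma\in S_m}(-1)^\sigma H_{(\alpha_1+\sigma(1)-1,\ \alpha_2+\sigma(2)-2,\ \ldots,\ \alpha_m+\sigma(m)-m)}\in\operatorname{NSym}.$$ *)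

theory Defs
  imports "HOL-Library.Poly_Mapping" "HOL-Combinatorics.Permutations"
begin

text \<open>Words form a separate type because monomials must be an instance of
  \<^class>\<open>monoid_add\<close> with concatenation as its operation: the product on
  \<^type>\<open>poly_mapping\<close> is convolution over the additive monoid of monomials.
  The letter \<open>i\<close> stands for the variable \<open>H\<close> of index \<open>i + 1\<close>.\<close>

datatype word = Word (letters: "nat list")

instantiation word :: monoid_add
begin

definition zero_word :: word
  where "zero_word = Word []"

definition plus_word :: "word \<Rightarrow> word \<Rightarrow> word"
  where "plus_word u v = Word (letters u @ letters v)"

instance
  by standard (simp_all add: zero_word_def plus_word_def)

end

text \<open>The monoid algebra of the free monoid, that is, the free associative
  unital algebra on the variables of index \<open>1, 2, \<dots>\<close>.\<close>

type_synonym 'k nsym = "word \<Rightarrow>\<^sub>0 'k"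

definition H :: "int \<Rightarrow> 'k::comm_ring_1 nsym"
  where "H k = (if k < 0 then 0 else if k = 0 then 1
     else Poly_Mapping.single (Word [nat (k - 1)]) 1)"

definition H_tuple :: "int list \<Rightarrow> 'k::comm_ring_1 nsym"
  where "H_tuple \<alpha> = prod_list (map H \<alpha>)"

text \<open>List positions start at \<open>0\<close>, so the \<open>i\<close>-th entry of a tuple is \<open>\<alpha> ! (i - 1)\<close>.\<close>

definition immaculate :: "int list \<Rightarrow> 'k::comm_ring_1 nsym"
  where "immaculate \<alpha> =
    (\<Sum>\<sigma> | \<sigma> permutes {1..length \<alpha>}.
       of_int (sign \<sigma>) *
       H_tuple (map (\<lambda>i. \<alpha> ! (i - 1) + int (\<sigma> i) - int i) [1..<length \<alpha> + 1]))"

text \<open>A sum over an infinite set would be \<open>0\<close> by convention; the following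
  index sets are finite.\<close>

lemma finite_immaculate_pieri_index:
  assumes "length \<alpha> = n"
  shows "finite {\<beta> :: int list. length \<beta> = n + 1 \<and> sum_list \<beta> = sum_list \<alpha> + s \<and>
    (\<forall>i\<in>{1..n}. \<alpha> ! (i - 1) \<le> \<beta> ! (i - 1)) \<and> 0 \<le> \<beta> ! n}" (is "finite ?B")
proof -
  define c where "c = \<alpha> @ [0]"
  have c: "length c = n + 1" "sum_list c = sum_list \<alpha>"
    using assms by (simp_all add: c_def)
  define L where "L = Min (insert 0 (set c))"
  define U where "U = Max (insert 0 (set c)) + \<bar>s\<bar>"
  have "?B \<subseteq> {\<beta>. set \<beta> \<subseteq> {L..U} \<and> length \<beta> = n + 1}"
  proof (intro subsetI CollectI)
    fix \<beta> assume "\<beta> \<in> ?B"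
    then have b: "length \<beta> = n + 1" "sum_list \<beta> = sum_list \<alpha> + s"
      and le: "\<And>i. i \<in> {1..n} \<Longrightarrow> \<alpha> ! (i - 1) \<le> \<beta> ! (i - 1)" and last: "0 \<le> \<beta> ! n" by auto
    have ge: "c ! j \<le> \<beta> ! j" if "j < n + 1" for j
      using le[of "Suc j"] last that assms by (cases "j = n") (auto simp: c_def nth_append)
    have sm: "(\<Sum>j<n + 1. \<beta> ! j - c ! j) = s"
      using b c by (simp add: sum_subtractf sum_list_sum_nth atLeast0LessThan)
    have "\<beta> ! j \<in> {L..U}" if j: "j < n + 1" for j
    proof -
      have "\<beta> ! j - c ! j \<le> (\<Sum>j<n + 1. \<beta> ! j - c ! j)"
        by (rule member_le_sum) (use j ge in auto)
      moreover have "c ! j \<in> set c" using j c by simp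
      then have "L \<le> c ! j" "c ! j \<le> Max (insert 0 (set c))"
        unfolding L_def by auto
      ultimately show ?thesis using sm ge[OF j] by (simp add: U_def)
    qed
    then show "set \<beta> \<subseteq> {L..U} \<and> length \<beta> = n + 1"
      using b by (auto simp: in_set_conv_nth)
  qed
  then show ?thesis
    by (rule finite_subset) (simp add: finite_lists_length_eq)
qed

end

theory Submission
  imports Defs
begin

text \<open>Expand the right-hand side and collect it by the tuple \<open>\<gamma> = \<beta> + \<sigma> - id\<close>. The
  coefficient of \<open>H\<^sub>\<gamma>\<close> is a signed sum over those \<open>\<sigma>\<close> that satisfy \<open>\<sigma>(i) \<le> c\<^sub>i\<close> for bounds
  \<open>c\<^sub>i\<close> read off from \<open>\<gamma>\<close>, that is, the determinant of a matrix whose rows are \<open>c\<^sub>i\<close> ones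
  followed by zeros. It vanishes unless the bounds, cut off at \<open>n + 1\<close>, form a permutation
  \<open>\<tau>\<close>, and then it equals the sign of \<open>\<tau>\<close>. As \<open>H\<^sub>\<gamma> = 0\<close> for \<open>\<gamma>\<^sub>n\<^sub>+\<^sub>1 < 0\<close>, one may assume that
  \<open>\<tau>\<close> fixes \<open>n + 1\<close>, and the terms that remain are those of the left-hand side.\<close>

section \<open>Index tuples of the summands of an immaculate function\<close>

text \<open>A name for the index tuple allows both viewpoints of the proof: for a fixed tuple it is
  injective in the permutation, for a fixed permutation it is a translation of tuples.\<close>

definition perm_shift :: "int list \<Rightarrow> (nat \<Rightarrow> nat) \<Rightarrow> int list"
  where "perm_shift \<alpha> \<sigma> =
    map (\<lambda>i. \<alpha> ! (i - 1) + int (\<sigma> i) - int i) [1..<length \<alpha> + 1]"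

lemma immaculate_perm_shift:
  "immaculate \<alpha> =
    (\<Sum>\<sigma> | \<sigma> permutes {1..length \<alpha>}. of_int (sign \<sigma>) * H_tuple (perm_shift \<alpha> \<sigma>))"
  by (simp only: immaculate_def perm_shift_def)

lemma ball_atLeast1_atMost_iff: "(\<forall>i\<in>{1..m}. P i) \<longleftrightarrow> (\<forall>k<m. P (Suc k))"
proof -
  have "(\<forall>i\<in>{1..m}. P i) \<longleftrightarrow> (\<forall>i\<in>Suc ` {..<m}. P i)"
    by (simp only: image_Suc_lessThan)
  also have "\<dots> \<longleftrightarrow> (\<forall>k<m. P (Suc k))" by blast
  finally show ?thesis .
qed

lemma length_perm_shift [simp]: "length (perm_shift \<alpha> \<sigma>) = length \<alpha>"
  by (simp add: perm_shift_def del: upt_Suc)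

lemma nth_perm_shift [simp]:
  "k < length \<alpha> \<Longrightarrow> perm_shift \<alpha> \<sigma> ! k = \<alpha> ! k + int (\<sigma> (Suc k)) - int (Suc k)"
  by (simp add: perm_shift_def del: upt_Suc)

text \<open>The values \<open>\<sigma> i\<close> rearrange the numbers from 1 to
  \<open>length \<alpha>\<close>, so the added and the subtracted terms cancel in total.\<close>

lemma sum_list_perm_shift:
  assumes "\<sigma> permutes {1..length \<alpha>}"
  shows "sum_list (perm_shift \<alpha> \<sigma>) = sum_list \<alpha>"
proof -
  have "(\<Sum>i\<in>{1..length \<alpha>}. int (\<sigma> i)) = (\<Sum>i\<in>{1..length \<alpha>}. int i)"
    using sum.permute[OF assms, of int] by (simp add: o_def)
  then have "(\<Sum>k<length \<alpha>. int (\<sigma> (Suc k))) = (\<Sum>k<length \<alpha>. int (Suc k))"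
    by (simp only: One_nat_def sum.atLeast1_atMost_eq)
  then show ?thesis
    by (simp add: sum_list_sum_nth atLeast0LessThan sum.distrib sum_subtractf)
qed

text \<open>As \<open>\<tau>\<close> fixes every point outside \<open>{1..length \<alpha>}\<close>,
  the new last position is not shifted.\<close>

lemma perm_shift_append:
  assumes "\<tau> permutes {1..length \<alpha>}"
  shows "perm_shift (\<alpha> @ [s]) \<tau> = perm_shift \<alpha> \<tau> @ [s]"
proof (rule nth_equalityI)
  have "\<tau> (Suc (length \<alpha>)) = Suc (length \<alpha>)"
    using permutes_not_in[OF assms] by simp
  then show "perm_shift (\<alpha> @ [s]) \<tau> ! k = (perm_shift \<alpha> \<tau> @ [s]) ! k"
    if "k < length (perm_shift (\<alpha> @ [s]) \<tau>)" for k
    using that by (auto simp: nth_append less_Suc_eq)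
qed simp

lemma inj_on_perm_shift: "inj_on (perm_shift \<alpha>) {\<sigma>. \<sigma> permutes {1..length \<alpha>}}"
proof (rule inj_onI, clarify)
  fix \<sigma> \<tau> assume p: "\<sigma> permutes {1..length \<alpha>}" "\<tau> permutes {1..length \<alpha>}"
    and eq: "perm_shift \<alpha> \<sigma> = perm_shift \<alpha> \<tau>"
  show "\<sigma> = \<tau>"
  proof
    fix i show "\<sigma> i = \<tau> i"
    proof (cases "i \<in> {1..length \<alpha>}")
      case True
      then obtain k where "i = Suc k" "k < length \<alpha>" by (cases i) auto
      then show ?thesis using nth_perm_shift[of k \<alpha> \<sigma>] nth_perm_shift[of k \<alpha> \<tau>] eq by simp
    next
      case False
      then show ?thesis using p by (simp add: permutes_not_in)
    qed
  qed
qed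

lemma H_tuple_append: "H_tuple (xs @ ys) = H_tuple xs * H_tuple ys"
  by (simp add: H_tuple_def)

text \<open>Right multiplication by \<open>H s\<close> appends \<open>s\<close> to each index tuple.
  The product is thus the part of the expansion of \<open>immaculate (\<alpha> @ [s])\<close> that
  belongs to the permutations fixing the last position.\<close>

lemma immaculate_times_H:
  "immaculate \<alpha> * H s =
    (\<Sum>\<tau> | \<tau> permutes {1..length \<alpha>}. of_int (sign \<tau>) * H_tuple (perm_shift (\<alpha> @ [s]) \<tau>))"
  unfolding immaculate_perm_shift sum_distrib_right
  by (intro sum.cong) (auto simp: perm_shift_append H_tuple_append mult.assoc H_tuple_def)

lemma H_tuple_eq_0:
  assumes "k \<in> set \<gamma>" "k < 0"
  shows "H_tuple \<gamma> = 0"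
  using assms by (induction \<gamma>) (auto simp: H_tuple_def H_def)

section \<open>Signed sums over permutations below given bounds\<close>

text \<open>Both permutations have the same sum of values over \<open>S\<close>, which leaves no
  room for a strict inequality.\<close>

lemma permutes_le_imp_eq:
  fixes \<sigma> \<tau> :: "nat \<Rightarrow> nat"
  assumes \<sigma>: "\<sigma> permutes S" and \<tau>: "\<tau> permutes S" and "finite S"
    and le: "\<And>i. i \<in> S \<Longrightarrow> \<sigma> i \<le> \<tau> i"
  shows "\<sigma> = \<tau>"
proof -
  have "(\<Sum>i\<in>S. \<sigma> i) = (\<Sum>i\<in>S. \<tau> i)"
    using sum.permute[OF \<sigma>, of id] sum.permute[OF \<tau>, of id] by simp
  then have "\<sigma> i = \<tau> i" if "i \<in> S" for i
    using sum_mono_inv[of \<sigma> S \<tau> i] le that \<open>finite S\<close> by blast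
  then show ?thesis
    using permutes_not_in[OF \<sigma>] permutes_not_in[OF \<tau>] by (metis ext)
qed

text \<open>Composition with the transposition of \<open>i\<close> and \<open>j\<close> is a
  sign-reversing involution, and the equal bounds make it preserve the index set. The sum is an
  integer, so being its own negative forces it to be 0, whatever the characteristic of the
  coefficient ring.\<close>

lemma sum_sign_bounded_perms_noninj:
  fixes c :: "'a::preorder \<Rightarrow> 'a"
  assumes "finite S" and ij: "i \<in> S" "j \<in> S" "i \<noteq> j" and c: "c i = c j"
  shows "(\<Sum>\<sigma> | \<sigma> permutes S \<and> (\<forall>k\<in>S. \<sigma> k \<le> c k). sign \<sigma>) = 0" (is "sum _ ?A = 0")
proof -
  let ?t = "transpose i j"
  have t: "?t permutes S" using ij by (simp add: permutes_swap_id)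
  have ct: "c (?t k) = c k" for k using c by (auto simp: transpose_def)
  have A: "\<sigma> \<circ> ?t \<in> ?A" if \<sigma>: "\<sigma> \<in> ?A" for \<sigma>
  proof -
    have "\<sigma> (?t k) \<le> c k" if "k \<in> S" for k
    proof -
      have "?t k \<in> S" using permutes_in_image[OF t] that by simp
      then have "\<sigma> (?t k) \<le> c (?t k)" using \<sigma> by blast
      then show ?thesis by (simp only: ct)
    qed
    then show ?thesis using \<sigma> permutes_compose[OF t] by simp
  qed
  have "sign (\<sigma> \<circ> ?t) = - sign \<sigma>" if "\<sigma> \<in> ?A" for \<sigma>
  proof -
    have "permutation \<sigma>" "permutation ?t"
      using that t \<open>finite S\<close> permutation_permutes by blast+
    then show ?thesis using ij by (simp add: sign_compose sign_swap_id)
  qed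
  moreover have "(\<Sum>\<sigma>\<in>?A. sign \<sigma>) = (\<Sum>\<sigma>\<in>?A. sign (\<sigma> \<circ> ?t))"
    by (rule sum.reindex_bij_witness[of _ "\<lambda>\<sigma>. \<sigma> \<circ> ?t" "\<lambda>\<sigma>. \<sigma> \<circ> ?t"])
      (use A in \<open>auto simp: comp_assoc\<close>)
  ultimately show ?thesis by (simp add: sum_negf)
qed

lemma sum_sign_bounded_perms_permutes:
  fixes \<tau> :: "nat \<Rightarrow> nat"
  assumes "\<tau> permutes S" "finite S"
  shows "(\<Sum>\<sigma> | \<sigma> permutes S \<and> (\<forall>k\<in>S. \<sigma> k \<le> \<tau> k). sign \<sigma>) = sign \<tau>"
proof -
  have "{\<sigma>. \<sigma> permutes S \<and> (\<forall>k\<in>S. \<sigma> k \<le> \<tau> k)} = {\<tau>}"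
    using permutes_le_imp_eq[OF _ assms] assms(1) by auto
  then show ?thesis by simp
qed

text \<open>A bound below 1 would exclude all permutations, and two bounds that agree after the cut
  at \<open>m\<close> would make the sum cancel. So the cut bounds form an injective self-map of
  \<open>{1..m}\<close>, hence a permutation.\<close>

lemma sum_sign_bounded_perms_nonzero:
  assumes "(\<Sum>\<sigma> | \<sigma> permutes {1..m} \<and> (\<forall>k\<in>{1..m}. int (\<sigma> k) \<le> c k). sign \<sigma>) \<noteq> 0"
  obtains \<tau> where "\<tau> permutes {1..m}" "\<And>k. k \<in> {1..m} \<Longrightarrow> int (\<tau> k) = min (c k) (int m)"
proof -
  \<comment> \<open>The cut at \<open>m\<close> is harmless because the permutations take no larger
    values on \<open>{1..m}\<close>, \<open>nat\<close> loses nothing once \<open>pos\<close> is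
    known, and \<open>permutes\<close> demands the identity off \<open>{1..m}\<close>.\<close>
  define d where "d k = (if k \<in> {1..m} then nat (min (c k) (int m)) else k)" for k
  have pos: "1 \<le> c k" if k: "k \<in> {1..m}" for k
  proof (rule ccontr)
    assume "\<not> 1 \<le> c k"
    moreover have "1 \<le> \<sigma> k" if "\<sigma> permutes {1..m}" for \<sigma>
      using permutes_in_image[OF that, of k] k by simp
    ultimately have "{\<sigma>. \<sigma> permutes {1..m} \<and> (\<forall>k\<in>{1..m}. int (\<sigma> k) \<le> c k)} = {}"
      using k by force
    then show False using assms by (metis sum.empty)
  qed
  have le_d: "int (\<sigma> k) \<le> c k \<longleftrightarrow> \<sigma> k \<le> d k" if "\<sigma> permutes {1..m}" "k \<in> {1..m}" for \<sigma> k
    using permutes_in_image[OF that(1), of k] that(2) pos[OF that(2)] by (auto simp: d_def)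
  have "{\<sigma>. \<sigma> permutes {1..m} \<and> (\<forall>k\<in>{1..m}. int (\<sigma> k) \<le> c k)} =
      {\<sigma>. \<sigma> permutes {1..m} \<and> (\<forall>k\<in>{1..m}. \<sigma> k \<le> d k)}"
    using le_d by blast
  then have nz: "(\<Sum>\<sigma> | \<sigma> permutes {1..m} \<and> (\<forall>k\<in>{1..m}. \<sigma> k \<le> d k). sign \<sigma>) \<noteq> 0"
    using assms by simp
  have "inj_on d {1..m}"
  proof (rule inj_onI, rule ccontr)
    fix i j assume "i \<in> {1..m}" "j \<in> {1..m}" "d i = d j" "i \<noteq> j"
    then show False
      using nz sum_sign_bounded_perms_noninj[of "{1..m}" i j d] by simp
  qed
  moreover have "d ` {1..m} \<subseteq> {1..m}" using pos by (force simp: d_def)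
  ultimately have "bij_betw d {1..m} {1..m}"
    by (simp add: bij_betw_def endo_inj_surj)
  then have "d permutes {1..m}" by (rule bij_imp_permutes) (auto simp: d_def)
  moreover have "int (d k) = min (c k) (int m)" if "k \<in> {1..m}" for k
    using that pos[OF that] by (auto simp: d_def)
  ultimately show ?thesis using that by blast
qed

section \<open>Collecting the right-hand side by index tuples\<close>

text \<open>The appended 0 makes the condition on the last entry of \<open>\<beta>\<close> one more
  inequality of the same form as the others.\<close>

lemma immaculate_times_H_nonneg:
  fixes \<alpha> :: "int list" and s :: int
  defines "m \<equiv> Suc (length \<alpha>)"
  defines "B \<equiv> {\<beta>. length \<beta> = m \<and> sum_list \<beta> = sum_list \<alpha> + s \<and>
    (\<forall>k<m. (\<alpha> @ [0]) ! k \<le> \<beta> ! k)}"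
  assumes fin: "finite B" and s: "0 \<le> s"
  shows "(immaculate \<alpha> :: 'k::comm_ring_1 nsym) * H s = (\<Sum>\<beta>\<in>B. immaculate \<beta>)"
proof -
  define a where "a = \<alpha> @ [0]"
  define P where "P = {\<sigma>. \<sigma> permutes {1..m}}"
  \<comment> \<open>This is the inequality \<open>a ! (i - 1) \<le> \<beta> ! (i - 1)\<close> for
    \<open>\<gamma> = perm_shift \<beta> \<sigma>\<close>, solved for
    \<open>\<sigma> i\<close>.\<close>
  define c where "c \<gamma> i = \<gamma> ! (i - 1) - a ! (i - 1) + int i" for \<gamma> i
  define T where "T = {\<gamma>. length \<gamma> = m \<and> sum_list \<gamma> = sum_list \<alpha> + s}"
  define G where "G \<sigma> = {\<gamma>\<in>T. \<forall>i\<in>{1..m}. int (\<sigma> i) \<le> c \<gamma> i}" for \<sigma>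
  \<comment> \<open>Exchanging the sums needs a finite range for \<open>\<gamma>\<close>;
    \<open>T\<close> may be infinite, but only the tuples in \<open>U\<close> occur.\<close>
  define U where "U = (\<Union>\<sigma>\<in>P. G \<sigma>)"
  define D where "D \<gamma> = (\<Sum>\<sigma> | \<sigma> permutes {1..m} \<and> (\<forall>i\<in>{1..m}. int (\<sigma> i) \<le> c \<gamma> i). sign \<sigma>)"
    for \<gamma>
  \<comment> \<open>By \<open>immaculate_times_H\<close>, the tuples \<open>g \<tau>\<close> for
    \<open>\<tau>\<close> in \<open>Q\<close> index the left-hand side.\<close>
  define Q where "Q = {\<tau>. \<tau> permutes {1..length \<alpha>}}"
  define g where "g = perm_shift (\<alpha> @ [s])"
  have finP: "finite P" by (simp add: P_def finite_permutations)
  have QP: "Q \<subseteq> P" unfolding P_def Q_def m_def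
    by (auto intro: permutes_subset)
  have bounds: "(\<forall>k<m. a ! k + int (\<sigma> (Suc k)) - int (Suc k) \<le> \<gamma> ! k) \<longleftrightarrow>
      (\<forall>i\<in>{1..m}. int (\<sigma> i) \<le> c \<gamma> i)" for \<sigma> :: "nat \<Rightarrow> nat" and \<gamma>
    unfolding ball_atLeast1_atMost_iff by (auto simp: c_def algebra_simps)
  have bij: "bij_betw (\<lambda>\<beta>. perm_shift \<beta> \<sigma>) B (G \<sigma>)" if "\<sigma> \<in> P" for \<sigma>
  proof (rule bij_betwI')
    show "perm_shift \<beta> \<sigma> = perm_shift \<beta>' \<sigma> \<longleftrightarrow> \<beta> = \<beta>'" if "\<beta> \<in> B" "\<beta>' \<in> B" for \<beta> \<beta>'
    proof
      assume eq: "perm_shift \<beta> \<sigma> = perm_shift \<beta>' \<sigma>"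
      show "\<beta> = \<beta>'"
      proof (rule nth_equalityI)
        show "\<beta> ! k = \<beta>' ! k" if "k < length \<beta>" for k
          using nth_perm_shift[of k \<beta> \<sigma>] nth_perm_shift[of k \<beta>' \<sigma>] eq that
            \<open>\<beta> \<in> B\<close> \<open>\<beta>' \<in> B\<close> by (simp add: B_def)
      qed (use that in \<open>simp add: B_def\<close>)
    qed simp
  next
    show "perm_shift \<beta> \<sigma> \<in> G \<sigma>" if "\<beta> \<in> B" for \<beta>
      using that \<open>\<sigma> \<in> P\<close> unfolding G_def bounds[symmetric]
      by (simp add: T_def B_def P_def sum_list_perm_shift flip: a_def)
  next
    fix \<gamma> assume \<gamma>: "\<gamma> \<in> G \<sigma>"
    then have len: "length \<gamma> = m" by (simp add: G_def T_def)
    define \<beta> where "\<beta> = map (\<lambda>k. \<gamma> ! k - int (\<sigma> (Suc k)) + int (Suc k)) [0..<m]"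
    have eq: "perm_shift \<beta> \<sigma> = \<gamma>"
      by (rule nth_equalityI) (simp_all add: \<beta>_def len)
    have "length \<beta> = m" by (simp add: \<beta>_def)
    moreover from this have "sum_list \<beta> = sum_list \<gamma>"
      using sum_list_perm_shift[of \<sigma> \<beta>] \<open>\<sigma> \<in> P\<close> eq by (simp add: P_def)
    ultimately have "\<beta> \<in> B"
      using \<gamma> unfolding G_def bounds[symmetric]
      by (auto simp: B_def T_def \<beta>_def algebra_simps simp flip: a_def)
    then show "\<exists>\<beta>\<in>B. \<gamma> = perm_shift \<beta> \<sigma>" using eq by auto
  qed
  have finG: "finite (G \<sigma>)" if "\<sigma> \<in> P" for \<sigma>
    using bij_betw_finite[OF bij[OF that]] fin by simp
  have finU: "finite U" using finP finG by (simp add: U_def)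

  \<comment> \<open>The bounds of \<open>g \<tau>\<close> are the values of \<open>\<tau>\<close>,
    except for \<open>m + s\<close> at position \<open>m\<close>. Since \<open>0 \<le> s\<close>,
    that one restricts no more than \<open>\<tau> m = m\<close> does, and only
    \<open>\<sigma> = \<tau>\<close> meets all bounds.\<close>
  have D_g: "D (g \<tau>) = sign \<tau>" and gU: "g \<tau> \<in> U" if \<tau>: "\<tau> \<in> Q" for \<tau>
  proof -
    have \<tau>m: "\<tau> permutes {1..m}" using QP \<tau> by (auto simp: P_def)
    have fix_m: "\<tau> m = m" using \<tau> by (auto simp: Q_def m_def intro: permutes_not_in)
    have c: "c (g \<tau>) i = (if i = m then int m + s else int (\<tau> i))" if "i \<in> {1..m}" for i
    proof -
      obtain k where "i = Suc k" "k < m" using \<open>i \<in> {1..m}\<close> by (cases i) auto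
      then show ?thesis using fix_m
        by (auto simp: c_def g_def a_def m_def nth_append less_Suc_eq)
    qed
    have iff: "int (\<sigma> i) \<le> c (g \<tau>) i \<longleftrightarrow> \<sigma> i \<le> \<tau> i"
      if \<sigma>: "\<sigma> permutes {1..m}" and i: "i \<in> {1..m}" for \<sigma> i
      using permutes_in_image[OF \<sigma>, of i] i s by (auto simp: c fix_m)
    have "{\<sigma>. \<sigma> permutes {1..m} \<and> (\<forall>i\<in>{1..m}. int (\<sigma> i) \<le> c (g \<tau>) i)} =
        {\<sigma>. \<sigma> permutes {1..m} \<and> (\<forall>i\<in>{1..m}. \<sigma> i \<le> \<tau> i)}"
      using iff by blast
    then show "D (g \<tau>) = sign \<tau>"
      using sum_sign_bounded_perms_permutes[OF \<tau>m] by (simp add: D_def)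
    have "g \<tau> \<in> T"
      using sum_list_perm_shift[of \<tau> "\<alpha> @ [s]"] \<tau>m by (simp add: T_def g_def m_def)
    then have "g \<tau> \<in> G \<tau>" using iff[OF \<tau>m] by (simp add: G_def)
    then show "g \<tau> \<in> U" using \<tau>m by (auto simp: U_def P_def)
  qed

  have vanish: "of_int (D \<gamma>) * H_tuple \<gamma> = (0 :: 'k nsym)" if "\<gamma> \<in> U" "\<gamma> \<notin> g ` Q" for \<gamma>
  proof (rule ccontr)
    assume nz: "of_int (D \<gamma>) * H_tuple \<gamma> \<noteq> (0 :: 'k nsym)"
    have "\<gamma> \<in> T" using \<open>\<gamma> \<in> U\<close> by (auto simp: U_def G_def)
    then have len: "length \<gamma> = m" and sum: "sum_list \<gamma> = sum_list \<alpha> + s"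
      by (auto simp: T_def)
    have last: "0 \<le> \<gamma> ! length \<alpha>"
    proof (rule ccontr)
      assume "\<not> 0 \<le> \<gamma> ! length \<alpha>"
      then have "H_tuple \<gamma> = (0 :: 'k nsym)"
        using H_tuple_eq_0[of "\<gamma> ! length \<alpha>" \<gamma>] len by (simp add: m_def)
      then show False using nz by simp
    qed
    have "D \<gamma> \<noteq> 0" using nz by auto
    then obtain \<tau> where \<tau>: "\<tau> permutes {1..m}"
      and \<tau>c: "\<And>k. k \<in> {1..m} \<Longrightarrow> int (\<tau> k) = min (c \<gamma> k) (int m)"
      unfolding D_def by (rule sum_sign_bounded_perms_nonzero) blast
    \<comment> \<open>A nonnegative last entry puts the last bound at \<open>m\<close> or above, so
      the cut makes it exactly \<open>m\<close>.\<close>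
    have "int (\<tau> m) = int m" using \<tau>c[of m] last by (simp add: m_def c_def a_def nth_append)
    then have \<tau>m: "\<tau> m = m" by simp
    have "\<tau> permutes {1..length \<alpha>}"
      by (rule permutes_superset[OF \<tau>]) (auto simp: \<tau>m[unfolded m_def] m_def le_Suc_eq)
    then have \<tau>Q: "\<tau> \<in> Q" by (simp add: Q_def)
    have nth: "\<gamma> ! k = perm_shift \<alpha> \<tau> ! k" if k: "k < length \<alpha>" for k
    proof -
      \<comment> \<open>By injectivity the value \<open>m\<close> is already taken, so at the other
        positions the cut is inactive and \<open>\<tau>\<close> determines the entries of
        \<open>\<gamma>\<close>.\<close>
      have "\<tau> (Suc k) \<noteq> \<tau> m"
        using permutes_inj[OF \<tau>] k by (auto simp: m_def dest: injD)
      then have "int (\<tau> (Suc k)) = c \<gamma> (Suc k)"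
        using \<tau>c[of "Suc k"] \<tau>m k by (auto simp: m_def)
      then show ?thesis using k by (simp add: c_def a_def nth_append)
    qed
    then have init: "take (length \<alpha>) \<gamma> = perm_shift \<alpha> \<tau>"
      by (intro nth_equalityI) (simp_all add: len m_def)
    have split: "\<gamma> = perm_shift \<alpha> \<tau> @ [\<gamma> ! length \<alpha>]"
      using take_Suc_conv_app_nth[of "length \<alpha>" \<gamma>] init len by (simp add: m_def)
    \<comment> \<open>The prescribed total now forces the last entry to be \<open>s\<close>.\<close>
    have "sum_list \<gamma> = sum_list \<alpha> + \<gamma> ! length \<alpha>"
      using arg_cong[OF split, of sum_list] \<tau>Q by (simp add: sum_list_perm_shift Q_def)
    then have "\<gamma> = g \<tau>"
      using split sum \<tau>Q by (simp add: g_def perm_shift_append Q_def)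
    then show False using \<open>\<gamma> \<notin> g ` Q\<close> \<tau>Q by blast
  qed

  have "(\<Sum>\<beta>\<in>B. immaculate \<beta>) =
      (\<Sum>\<beta>\<in>B. \<Sum>\<sigma>\<in>P. of_int (sign \<sigma>) * (H_tuple (perm_shift \<beta> \<sigma>) :: 'k nsym))"
    by (intro sum.cong) (auto simp: immaculate_perm_shift P_def B_def)
  also have "\<dots> = (\<Sum>\<sigma>\<in>P. \<Sum>\<beta>\<in>B. of_int (sign \<sigma>) * H_tuple (perm_shift \<beta> \<sigma>))"
    by (rule sum.swap)
  also have "\<dots> = (\<Sum>\<sigma>\<in>P. \<Sum>\<gamma>\<in>G \<sigma>. of_int (sign \<sigma>) * H_tuple \<gamma>)"
    by (rule sum.cong[OF refl]) (rule sum.reindex_bij_betw[OF bij])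
  also have "\<dots> = (\<Sum>\<sigma>\<in>P. \<Sum>\<gamma> | \<gamma> \<in> U \<and> \<gamma> \<in> G \<sigma>. of_int (sign \<sigma>) * H_tuple \<gamma>)"
    by (intro sum.cong refl) (auto simp: U_def)
  also have "\<dots> = (\<Sum>\<gamma>\<in>U. \<Sum>\<sigma> | \<sigma> \<in> P \<and> \<gamma> \<in> G \<sigma>. of_int (sign \<sigma>) * H_tuple \<gamma>)"
    by (rule sum.swap_restrict[OF finP finU])
  also have "\<dots> = (\<Sum>\<gamma>\<in>U. of_int (D \<gamma>) * H_tuple \<gamma>)"
  proof (rule sum.cong)
    fix \<gamma> assume "\<gamma> \<in> U"
    then have "\<gamma> \<in> T" by (auto simp: U_def G_def)
    then show "(\<Sum>\<sigma> | \<sigma> \<in> P \<and> \<gamma> \<in> G \<sigma>. of_int (sign \<sigma>) * H_tuple \<gamma>) =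
        of_int (D \<gamma>) * (H_tuple \<gamma> :: 'k nsym)"
      by (simp add: P_def G_def D_def sum_distrib_right)
  qed simp
  also have "\<dots> = (\<Sum>\<gamma>\<in>g ` Q. of_int (D \<gamma>) * H_tuple \<gamma>)"
    using gU vanish by (intro sum.mono_neutral_right finU) auto
  also have "\<dots> = (\<Sum>\<tau>\<in>Q. of_int (D (g \<tau>)) * H_tuple (g \<tau>))"
  proof -
    have "inj_on g Q"
      using inj_on_subset[OF inj_on_perm_shift[of "\<alpha> @ [s]"], of Q] QP
      by (simp add: g_def P_def m_def)
    then show ?thesis by (simp add: sum.reindex)
  qed
  also have "\<dots> = immaculate \<alpha> * H s"
    unfolding immaculate_times_H by (intro sum.cong) (simp_all add: D_g g_def[symmetric] Q_def)
  finally show ?thesis ..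
qed

theorem proposition3p8:
  fixes n :: nat and \<alpha> :: "int list" and s :: int
  assumes "length \<alpha> = n"
  shows "(immaculate \<alpha> :: 'k::comm_ring_1 nsym) * H s =
    (\<Sum>\<beta> | length \<beta> = n + 1 \<and> sum_list \<beta> = sum_list \<alpha> + s \<and>
            (\<forall>i\<in>{1..n}. \<alpha> ! (i - 1) \<le> \<beta> ! (i - 1)) \<and> 0 \<le> \<beta> ! n.
       immaculate \<beta>)"
    (is "_ = sum _ ?B")
proof -
  let ?C = "{\<beta>. length \<beta> = Suc (length \<alpha>) \<and> sum_list \<beta> = sum_list \<alpha> + s \<and>
    (\<forall>k<Suc (length \<alpha>). (\<alpha> @ [0]) ! k \<le> \<beta> ! k)}"
  have "(\<forall>i\<in>{1..n}. \<alpha> ! (i - 1) \<le> \<beta> ! (i - 1)) \<longleftrightarrow> (\<forall>k<n. \<alpha> ! k \<le> \<beta> ! k)"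
    for \<beta> :: "int list"
    unfolding ball_atLeast1_atMost_iff by simp
  then have B: "?B = ?C"
    using assms by (auto simp: nth_append less_Suc_eq)
  show ?thesis
  proof (cases "0 \<le> s")
    case True
    then show ?thesis
      using immaculate_times_H_nonneg[of \<alpha> s] finite_immaculate_pieri_index[OF assms, of s]
      unfolding B by simp
  next
    case False
    \<comment> \<open>For \<open>s < 0\<close> both sides vanish: \<open>H s\<close> is 0, and the
      entrywise inequalities contradict the smaller total required of
      \<open>\<beta>\<close>.\<close>
    have "sum_list \<alpha> \<le> sum_list \<beta>" if \<beta>: "\<beta> \<in> ?C" for \<beta>
    proof -
      have "(\<Sum>k<Suc (length \<alpha>). (\<alpha> @ [0]) ! k) \<le> (\<Sum>k<Suc (length \<alpha>). \<beta> ! k)"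
        using \<beta> by (intro sum_mono) auto
      moreover have "sum_list (\<alpha> @ [0]) = (\<Sum>k<Suc (length \<alpha>). (\<alpha> @ [0]) ! k)"
        by (simp only: sum_list_sum_nth atLeast0LessThan length_append_singleton)
      moreover have "sum_list \<beta> = (\<Sum>k<Suc (length \<alpha>). \<beta> ! k)"
        using \<beta> by (simp add: sum_list_sum_nth atLeast0LessThan)
      ultimately show ?thesis by simp
    qed
    then have empty: "?C = {}" using False by fastforce
    show ?thesis
      unfolding B empty using False by (simp add: H_def)
  qed
qed

end
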